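(* Let $s\in(1/2,1)$ and let $w$ be a mother wave packet with parameter $d$ as in the context. For a function $f(t)$ and $\varepsilon>0$ define $$R_\varepsilon=\{(a,b): |W_f(a,b)|\ge|a|^{-s/2}\sqrt\varepsilon\}$$ and $$Z_{n,k}=\{(a,b):|a-nN_k\phi_k'(b)|\le d|a|^s\}\qquad\text{for }1\le k\le K\text{ and }|n|\ge1.$$ For fixed $M$, $K_0$, $K$ and every $\varepsilon>0$, there exists a constant $N_0(M,K_0,K,s,\varepsilon)>0$ such that for every $N>N_0$ and every $f(t)=\sum_{k=1}^K\alpha_k(t)s_k(2\pi N_k\phi_k(t))\in wGF(M,N,K_0,K,s)$ the following statements hold. (i) For each $j$ there exists $n_j$ such that $\widehat{s_j}(n_j)\ne0$ and $Z_{n_j,j}\cap Z_{n,k}=\emptyset$ for all pairs $(n,k)\ne(n_j,j)$ with $\widehat{s_k}(n)\neq0$. (ii) For any $(a,b)\in R_\varepsilon\cap Z_{n_j,j}$, $$\frac{|v_f(a,b)-n_jN_j\phi_j'(b)|}{|n_jN_j\phi_j'(b)|}\lesssim\sqrt\varepsilon.$$ (iii) For each $j$, let $$l_{n_j}(b)=\min\{a:(a,b)\in R_\varepsilon\cap Z_{n_j,j}\},\qquad u_{n_j}(b)=\max\{a:(a,b)\in R_\varepsilon\cap Z_{n_j,j}\}.$$ Suppose $v_f(a,b)\ne\infty$. If $a\le l_{n_j}(b)$, then $v_f(a,b)\le l_{n_j}(b)(1+O(\sqrt\varepsilon))$. If $a\ge u_{n_j}(b)$, then $v_f(a,b)\ge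 u_{n_j}(b)(1-O(\sqrt\varepsilon))$. The implicit constants in $\lesssim$ and $O(\cdot)$ may depend on $M$, $K$ and $K_0$.
   Context: Fourier transform: $\widehat g(\xi)=\int_{\mathbb R} g(t)e^{-2\pi i t\xi}\,dt$. For a $2\pi$-periodic function $\sigma$, $\widehat{\sigma}(n)$ ($n\in\mathbb Z$) are its Fourier coefficients, $\sigma(t)=\sum_n\widehat{\sigma}(n)e^{int}$. The scalar $s\in(1/2,1)$ is a geometric scaling parameter, not to be confused with the shape functions $s_k$. Wave packets: the mother wave packet $w$ is a fixed function in the Schwartz class whose Fourier transform $\widehat w$ is real-valued, non-negative and smooth with support equal to $(-d,d)$, where $d\le1$. For $|a|\ge1$, $b\in\mathbb R$, $$w_{ab}(t)=|a|^{s/2}w(|a|^s(t-b))e^{2\pi i(t-b)a},\qquad W_f(a,b)=\int_{\mathbb R}\overline{w_{ab}(t)}f(t)\,dt .$$ The instantaneous frequency information function is $v_f(a,b)=\dfrac{\partial_bW_f(a,b)}{2\pi i\,W_f(a,b)}$ if $|W_f(a,b)|>0$, and $v_f(a,b)=\infty$ otherwise. Shape functions: $\mathcal S_M$ consists of the $2\pi$-periodic functions $\sigma$ in the Wiener algebra with unit $L^2([-\pi,\pi])$-norm and $L^\infty$-norm bounded by $M$ such that (1) the Fourier series of $\sigma$ is uniformly convergent; (2) $\sum_{n}|\widehat\sigma(n)|\le M$ and $\widehat\sigma(0)=0$; (3) the greatest common divisor of the elements of $\{|n|:\widehat\sigma(n)\ne0\}$ is $1$. A function $\alpha(t)\sigma(2\pi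 N\phi(t))$ is a general intrinsic mode type function (GIMT) of type $(M,N)$ if $\sigma\in\mathcal S_M$, $\alpha\in C^\infty$, $|\alpha'|\le M$, $1/M\le\alpha\le M$, and $\phi\in C^\infty$, $1/M\le|\phi'|\le M$, $|\phi''|\le M$. $wGF(M,N,K_0,K,s)$ (weak well-separated general superpositions) is the set of all $f=\sum_{k=1}^Kf_k$ where each $f_k(t)=\alpha_k(t)s_k(2\pi N_k\phi_k(t))$ is a GIMT of type $(M,N_k)$ with $N_k\ge N$, and, with $Z_{n,k}=\{(a,b):|a-nN_k\phi_k'(b)|\le d|a|^s\}$, the following weak well-separation conditions hold: (1) for each $k$ there exists $n_k$ such that $\widehat{s_k}(n_k)\ne0$ and $Z_{n_k,k}\cap Z_{n,j}=\emptyset$ for all pairs $(n,j)\ne(n_k,k)$ with $\widehat{s_j}(n)\ne0$; (2) $K_0<\infty$ is such that for all $a\in\mathbb R$ and all $b\in\mathbb R$ there exist at most $K_0$ pairs $(n,k)$ with $(a,b)\in Z_{n,k}$.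
   Formalization: Condition (2) of wGF, read literally, cannot hold for K≥1, so a version counting only pairs with ŝ_k(n)≠0 is also proved; there (iii), which fails for general (a,b) with v_f≠∞, is restricted to (a,b) in R_ε. The inequalities in (iii) concern Re v_f. *)

theory Defs
  imports "HOL-Analysis.Analysis"
begin

definition vderiv :: "(real \<Rightarrow> 'a::real_normed_vector) \<Rightarrow> real \<Rightarrow> 'a" where
  "vderiv g = (\<lambda>t. vector_derivative g (at t))"

definition smooth :: "(real \<Rightarrow> 'a::real_normed_vector) \<Rightarrow> bool" where
  "smooth g \<longleftrightarrow> (\<forall>n t. (vderiv ^^ n) g differentiable (at t))"

definition schwartz :: "(real \<Rightarrow> complex) \<Rightarrow> bool" where
  "schwartz g \<longleftrightarrow> smooth g \<and> (\<forall>m n. \<exists>B. \<forall>t. \<bar>t\<bar> ^ m * norm ((vderiv ^^ n) g t) \<le> B)"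

definition fourier :: "(real \<Rightarrow> complex) \<Rightarrow> real \<Rightarrow> complex" where
  "fourier g \<xi> = (LINT t|lborel. g t * cis (- (2 * pi * t * \<xi>)))"

text \<open>The support is the open interval, so it is the set where the transform does not vanish,
  not the closure of that set.\<close>
definition mother_wave_packet :: "real \<Rightarrow> (real \<Rightarrow> complex) \<Rightarrow> bool" where
  "mother_wave_packet d w \<longleftrightarrow> 0 < d \<and> d \<le> 1 \<and> schwartz w \<and>
     (\<forall>\<xi>. fourier w \<xi> \<in> \<real> \<and> 0 \<le> Re (fourier w \<xi>)) \<and> smooth (fourier w) \<and>
     {\<xi>. fourier w \<xi> \<noteq> 0} = {-d<..<d}"

definition wave_packet :: "(real \<Rightarrow> complex) \<Rightarrow> real \<Rightarrow> real \<Rightarrow> real \<Rightarrow> real \<Rightarrow> complex" where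
  "wave_packet w s a b t =
     of_real (\<bar>a\<bar> powr (s / 2)) * w (\<bar>a\<bar> powr s * (t - b)) * cis (2 * pi * (t - b) * a)"

text \<open>The transform is only meant for \<open>\<bar>a\<bar> \<ge> 1\<close>; the sets \<open>R\<close> and \<open>Q\<close> below carry that restriction.\<close>
definition wpt :: "(real \<Rightarrow> complex) \<Rightarrow> real \<Rightarrow> (real \<Rightarrow> complex) \<Rightarrow> real \<Rightarrow> real \<Rightarrow> complex" where
  "wpt w s f a b = (LINT t|lborel. cnj (wave_packet w s a b t) * f t)"

text \<open>\<open>None\<close> stands for the value \<open>\<infinity>\<close>.\<close>
definition inst_freq ::
  "(real \<Rightarrow> complex) \<Rightarrow> real \<Rightarrow> (real \<Rightarrow> complex) \<Rightarrow> real \<Rightarrow> real \<Rightarrow> complex option" where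
  "inst_freq w s f a b =
     (if norm (wpt w s f a b) > 0
      then Some (vderiv (wpt w s f a) b / (2 * of_real pi * \<i> * wpt w s f a b))
      else None)"

definition R_set ::
  "(real \<Rightarrow> complex) \<Rightarrow> real \<Rightarrow> real \<Rightarrow> (real \<Rightarrow> complex) \<Rightarrow> (real \<times> real) set" where
  "R_set w s \<epsilon> f =
     {(a, b). \<bar>a\<bar> \<ge> 1 \<and> norm (wpt w s f a b) \<ge> \<bar>a\<bar> powr (- s / 2) * sqrt \<epsilon>}"

definition Z_set :: "real \<Rightarrow> real \<Rightarrow> real \<Rightarrow> (real \<Rightarrow> real) \<Rightarrow> int \<Rightarrow> (real \<times> real) set" where
  "Z_set d s N \<phi> n = {(a, b). \<bar>a - of_int n * N * vderiv \<phi> b\<bar> \<le> d * \<bar>a\<bar> powr s}"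

definition fcoeff :: "(real \<Rightarrow> complex) \<Rightarrow> int \<Rightarrow> complex" where
  "fcoeff \<sigma> n = (LINT t:{-pi..pi}|lborel. \<sigma> t * cis (- (of_int n * t))) / (2 * of_real pi)"

definition wiener_algebra :: "(real \<Rightarrow> complex) \<Rightarrow> bool" where
  "wiener_algebra \<sigma> \<longleftrightarrow> (\<forall>t. \<sigma> (t + 2 * pi) = \<sigma> t) \<and>
     (\<lambda>n. norm (fcoeff \<sigma> n)) summable_on UNIV \<and>
     (\<forall>t. ((\<lambda>n. fcoeff \<sigma> n * cis (of_int n * t)) has_sum \<sigma> t) UNIV)"

text \<open>Functions in the Wiener algebra are continuous, so the \<open>L\<^sup>\<infinity>\<close> bound is pointwise.\<close>
definition shape_class :: "real \<Rightarrow> (real \<Rightarrow> complex) set" where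
  "shape_class M = {\<sigma>. wiener_algebra \<sigma> \<and>
     sqrt (LINT t:{-pi..pi}|lborel. (norm (\<sigma> t))\<^sup>2) = 1 \<and>
     (\<forall>t. norm (\<sigma> t) \<le> M) \<and>
     uniform_limit UNIV (\<lambda>m t. \<Sum>n = - int m..int m. fcoeff \<sigma> n * cis (of_int n * t)) \<sigma>
       sequentially \<and>
     (\<Sum>\<^sub>\<infinity>n. norm (fcoeff \<sigma> n)) \<le> M \<and> fcoeff \<sigma> 0 = 0 \<and>
     Gcd {\<bar>n\<bar> |n. fcoeff \<sigma> n \<noteq> 0} = 1}"

definition gimt ::
  "real \<Rightarrow> real \<Rightarrow> (real \<Rightarrow> complex) \<Rightarrow> (real \<Rightarrow> real) \<Rightarrow> (real \<Rightarrow> complex) \<Rightarrow> (real \<Rightarrow> real) \<Rightarrow> bool" where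
  "gimt M N g \<alpha> \<sigma> \<phi> \<longleftrightarrow> (\<forall>t. g t = of_real (\<alpha> t) * \<sigma> (2 * pi * N * \<phi> t)) \<and>
     \<sigma> \<in> shape_class M \<and>
     smooth \<alpha> \<and> (\<forall>t. \<bar>vderiv \<alpha> t\<bar> \<le> M \<and> 1 / M \<le> \<alpha> t \<and> \<alpha> t \<le> M) \<and>
     smooth \<phi> \<and> (\<forall>t. 1 / M \<le> \<bar>vderiv \<phi> t\<bar> \<and> \<bar>vderiv \<phi> t\<bar> \<le> M \<and> \<bar>vderiv (vderiv \<phi>) t\<bar> \<le> M)"

definition separated ::
  "nat \<Rightarrow> real \<Rightarrow> real \<Rightarrow> (nat \<Rightarrow> real \<Rightarrow> complex) \<Rightarrow> (nat \<Rightarrow> real) \<Rightarrow> (nat \<Rightarrow> real \<Rightarrow> real) \<Rightarrow>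
   nat \<Rightarrow> int \<Rightarrow> bool" where
  "separated K s d \<sigma> N \<phi> j m \<longleftrightarrow> fcoeff (\<sigma> j) m \<noteq> 0 \<and>
     (\<forall>k\<in>{1..K}. \<forall>n. (n, k) \<noteq> (m, j) \<and> fcoeff (\<sigma> k) n \<noteq> 0 \<longrightarrow>
        Z_set d s (N j) (\<phi> j) m \<inter> Z_set d s (N k) (\<phi> k) n = {})"

definition all_pairs :: "nat \<Rightarrow> (int \<times> nat) set" where
  "all_pairs K = {(n, k). n \<noteq> 0 \<and> k \<in> {1..K}}"

definition occurring_pairs :: "nat \<Rightarrow> (nat \<Rightarrow> real \<Rightarrow> complex) \<Rightarrow> (int \<times> nat) set" where
  "occurring_pairs K \<sigma> = {(n, k). (n, k) \<in> all_pairs K \<and> fcoeff (\<sigma> k) n \<noteq> 0}"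

text \<open>Membership of \<open>f\<close> in \<open>wGF\<close>, together with a decomposition witnessing it. The
  overlap bound \<open>K0\<close> counts the pairs in \<open>P\<close>. As literally defined, \<open>P\<close> is
  \<^const>\<open>all_pairs\<close>; this is unsatisfiable for \<open>K \<ge> 1\<close>, since at a fixed \<open>b\<close> the number of
  \<open>n\<close> with \<open>(a, b)\<close> in the \<open>n\<close>-th zone grows like \<open>\<bar>a\<bar> powr s\<close>. With
  \<^const>\<open>occurring_pairs\<close> only the zones of harmonics present in \<open>f\<close> are counted, which
  gives a larger, nontrivial class.\<close>
definition wGF_decomposition ::
  "(int \<times> nat) set \<Rightarrow> real \<Rightarrow> real \<Rightarrow> nat \<Rightarrow> nat \<Rightarrow> real \<Rightarrow> real \<Rightarrow> (real \<Rightarrow> complex) \<Rightarrow>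
   (nat \<Rightarrow> real \<Rightarrow> real) \<Rightarrow> (nat \<Rightarrow> real \<Rightarrow> complex) \<Rightarrow> (nat \<Rightarrow> real) \<Rightarrow> (nat \<Rightarrow> real \<Rightarrow> real) \<Rightarrow> bool" where
  "wGF_decomposition P M N K0 K s d f \<alpha> \<sigma> Nk \<phi> \<longleftrightarrow>
     (\<forall>t. f t = (\<Sum>k = 1..K. of_real (\<alpha> k t) * \<sigma> k (2 * pi * Nk k * \<phi> k t))) \<and>
     (\<forall>k\<in>{1..K}. Nk k \<ge> N \<and>
        gimt M (Nk k) (\<lambda>t. of_real (\<alpha> k t) * \<sigma> k (2 * pi * Nk k * \<phi> k t)) (\<alpha> k) (\<sigma> k) (\<phi> k)) \<and>
     (\<forall>k\<in>{1..K}. \<exists>m. separated K s d \<sigma> Nk \<phi> k m) \<and>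
     (\<forall>a b. finite {(n, k) \<in> P. (a, b) \<in> Z_set d s (Nk k) (\<phi> k) n} \<and>
            card {(n, k) \<in> P. (a, b) \<in> Z_set d s (Nk k) (\<phi> k) n} \<le> K0)"

definition is_min :: "real set \<Rightarrow> real \<Rightarrow> bool" where
  "is_min S x \<longleftrightarrow> x \<in> S \<and> (\<forall>y\<in>S. x \<le> y)"

definition is_max :: "real set \<Rightarrow> real \<Rightarrow> bool" where
  "is_max S x \<longleftrightarrow> x \<in> S \<and> (\<forall>y\<in>S. y \<le> x)"

definition freq_estimate ::
  "real \<Rightarrow> (real \<Rightarrow> complex) \<Rightarrow> real \<Rightarrow> real \<Rightarrow> real \<Rightarrow> (real \<Rightarrow> complex) \<Rightarrow> real \<Rightarrow> (real \<Rightarrow> real) \<Rightarrow> int \<Rightarrow> bool" where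
  "freq_estimate C w s d \<epsilon> f N \<phi> m \<longleftrightarrow>
     (\<forall>(a, b) \<in> R_set w s \<epsilon> f \<inter> Z_set d s N \<phi> m. \<exists>v. inst_freq w s f a b = Some v \<and>
        norm (v - of_real (of_int m * N * vderiv \<phi> b)) / \<bar>of_int m * N * vderiv \<phi> b\<bar> \<le> C * sqrt \<epsilon>)"

text \<open>The instantaneous frequency is complex in general; order comparisons are with its real
  part. \<open>Q\<close> is the set of points \<open>(a, b)\<close> at which it is compared with the extreme values
  \<open>l\<close> and \<open>u\<close>; outside \<^const>\<open>R_set\<close> the transform may nearly vanish, and then nothing bounds
  its instantaneous frequency. The factors \<open>1 \<plusminus> \<theta>\<close> spell out \<open>1 \<plusminus> O(sqrt \<epsilon>)\<close>.\<close>
definition edge_estimate ::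
  "(real \<times> real) set \<Rightarrow> real \<Rightarrow> (real \<Rightarrow> complex) \<Rightarrow> real \<Rightarrow> real \<Rightarrow> real \<Rightarrow> (real \<Rightarrow> complex) \<Rightarrow>
   real \<Rightarrow> (real \<Rightarrow> real) \<Rightarrow> int \<Rightarrow> bool" where
  "edge_estimate Q C w s d \<epsilon> f N \<phi> m \<longleftrightarrow>
     (\<forall>b. let S = {a. (a, b) \<in> R_set w s \<epsilon> f \<inter> Z_set d s N \<phi> m} in S \<noteq> {} \<longrightarrow>
        (\<exists>l u. is_min S l \<and> is_max S u \<and>
           (\<forall>a v. (a, b) \<in> Q \<and> inst_freq w s f a b = Some v \<longrightarrow>
              (a \<le> l \<longrightarrow> (\<exists>\<theta>. \<bar>\<theta>\<bar> \<le> C * sqrt \<epsilon> \<and> Re v \<le> l * (1 + \<theta>))) \<and>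
              (a \<ge> u \<longrightarrow> (\<exists>\<theta>. \<bar>\<theta>\<bar> \<le> C * sqrt \<epsilon> \<and> Re v \<ge> u * (1 - \<theta>))))))"

end

theory Submission
  imports Defs "HOL-Probability.Sinc_Integral"
begin

text \<open>
  Differentiating a wave packet \<open>w_ab(t)\<close> in \<open>b\<close> reproduces it with the factor \<open>- 2 \<pi> \<i> a\<close>, up to
  \<open>- |a|^s\<close> times the wave packet built from \<open>w'\<close>. Writing \<open>W\<close> and \<open>V\<close> for the transforms of \<open>f\<close>
  with respect to \<open>w\<close> and \<open>w'\<close>, this gives (\<open>vderiv_wpt\<close>)
  \<open>v_f(a,b) - a = - |a|^s V(a,b) / (2 \<pi> \<i> W(a,b))\<close>.
  Since \<open>f\<close> is bounded by \<open>K M^2\<close>, the size of \<open>V\<close> is at most a constant times \<open>|a|^(-s/2)\<close>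
  (\<open>norm_wpt_le\<close>), whereas \<open>|W| \<ge> |a|^(-s/2) sqrt \<epsilon>\<close> on \<open>R_\<epsilon>\<close>. The factors \<open>|a|^(-s/2)\<close> cancel and
  \<open>|v_f(a,b) - a| \<le> E |a|^s\<close> throughout \<open>R_\<epsilon>\<close>, with \<open>E\<close> depending on \<open>w\<close>, \<open>K\<close>, \<open>M\<close> and \<open>\<epsilon>\<close> only
  (\<open>inst_freq_near_scale\<close>).

  On a zone \<open>|a - c(b)| \<le> d |a|^s\<close> around \<open>c(b) = m N_j \<phi>_j'(b)\<close> with \<open>m \<noteq> 0\<close>, the lower bound
  \<open>|c(b)| \<ge> N / M\<close> forces \<open>|a|\<close> to be large when \<open>N\<close> is. As \<open>s < 1\<close>, both \<open>E |a|^s\<close> and \<open>d |a|^s\<close>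
  are then at most any prescribed fraction of \<open>|a|\<close>. So \<open>v_f\<close>, \<open>a\<close> and \<open>c(b)\<close> agree up to a relative
  error \<open>sqrt \<epsilon>\<close>; the threshold for \<open>N\<close> absorbs all constants, and \<open>C = 1\<close> serves. The comparison
  with the extreme scales \<open>l\<close> and \<open>u\<close> uses the bound for \<open>v_f - a\<close> at points of \<open>R_\<epsilon>\<close> beyond the zone
  (\<open>edge_upper_bound\<close>, \<open>edge_lower_bound\<close>). These extremes exist because the transform is continuous
  in \<open>a\<close> and the zone bounds \<open>a\<close> (\<open>R_set_meets_Z_set_extremal\<close>).

  If all harmonics count towards the overlap bound \<open>K0\<close>, there is nothing to estimate: arbitrarily
  many zones of a single component meet at a large scale, so such a decomposition has \<open>K = 0\<close>
  (\<open>all_pairs_overlap_unbounded\<close>).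
\<close>

section \<open>Derivatives of convolutions with decaying kernels\<close>

lemma has_vector_derivative_at_quotient:
  fixes f :: "real \<Rightarrow> 'a::real_normed_vector"
  shows "(f has_vector_derivative f') (at x) \<longleftrightarrow> ((\<lambda>y. (f y - f x) /\<^sub>R (y - x)) \<longlongrightarrow> f') (at x)"
proof -
  have *: "norm ((f y - f x - (y - x) *\<^sub>R f') /\<^sub>R norm (y - x)) = norm ((f y - f x) /\<^sub>R (y - x) - f')"
    if "y \<noteq> x" for y
  proof -
    have "(f y - f x) /\<^sub>R (y - x) - f' = (f y - f x - (y - x) *\<^sub>R f') /\<^sub>R (y - x)"
      using that by (simp add: scaleR_right_diff_distrib)
    thus ?thesis by (simp add: norm_inverse)
  qed
  have "(f has_vector_derivative f') (at x) \<longleftrightarrow>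
      ((\<lambda>y. (f y - f x - (y - x) *\<^sub>R f') /\<^sub>R norm (y - x)) \<longlongrightarrow> 0) (at x)"
    by (simp add: has_vector_derivative_def has_derivative_at_within bounded_linear_scaleR_left)
  also have "\<dots> \<longleftrightarrow> ((\<lambda>y. norm ((f y - f x - (y - x) *\<^sub>R f') /\<^sub>R norm (y - x))) \<longlongrightarrow> 0) (at x)"
    by (simp only: tendsto_norm_zero_iff)
  also have "\<dots> \<longleftrightarrow> ((\<lambda>y. norm ((f y - f x) /\<^sub>R (y - x) - f')) \<longlongrightarrow> 0) (at x)"
    by (intro filterlim_cong refl) (use * in \<open>auto simp: eventually_at_filter\<close>)
  also have "\<dots> \<longleftrightarrow> ((\<lambda>y. (f y - f x) /\<^sub>R (y - x)) \<longlongrightarrow> f') (at x)"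
    by (simp only: tendsto_norm_zero_iff LIM_zero_iff)
  finally show ?thesis .
qed

lemma integrable_Cauchy_kernel: "integrable lborel (\<lambda>t::real. C / (1 + (t - b)\<^sup>2))"
proof -
  have "integrable lborel (\<lambda>t::real. inverse (1 + t\<^sup>2))"
    using integrable_inverse_1_plus_square by (simp add: set_integrable_def einterval_eq)
  from lborel_integrable_real_affine[OF this, of 1 "-b"]
  have "integrable lborel (\<lambda>t. C * inverse (1 + (t - b)\<^sup>2))" by simp
  thus ?thesis by (simp add: divide_inverse)
qed

text \<open>Lets one integrable function dominate all difference quotients with increment at most 1.\<close>
lemma Cauchy_kernel_shift:
  fixes x y :: real
  assumes "\<bar>x - y\<bar> \<le> 1"
  shows "1 / (1 + y\<^sup>2) \<le> 3 / (1 + x\<^sup>2)"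
proof -
  have "(x - y)\<^sup>2 \<le> 1" using assms by (simp add: abs_square_le_1)
  moreover have "3 * (1 + y\<^sup>2) - (1 + x\<^sup>2) = 2 * (1 - (x - y)\<^sup>2) + (x - 2 * y)\<^sup>2 + y\<^sup>2"
    by (simp add: power2_eq_square algebra_simps)
  moreover have "0 \<le> 2 * (1 - (x - y)\<^sup>2) + (x - 2 * y)\<^sup>2 + y\<^sup>2"
    using \<open>(x - y)\<^sup>2 \<le> 1\<close> by (intro add_nonneg_nonneg mult_nonneg_nonneg) simp_all
  ultimately have "0 \<le> 3 * (1 + y\<^sup>2) - (1 + x\<^sup>2)" by (simp only:)
  hence "1 + x\<^sup>2 \<le> 3 * (1 + y\<^sup>2)" by simp
  moreover have "1 + x\<^sup>2 > 0" "1 + y\<^sup>2 > 0" by (simp_all add: add_pos_nonneg)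
  ultimately show ?thesis by (simp add: divide_simps)
qed

text \<open>The mean value inequality bounds the difference quotients of \<open>g\<close> by the supremum of \<open>g'\<close> near
  the point, which the kernel \<open>1 / (1 + x\<^sup>2)\<close> dominates up to the factor 3. Dominated convergence then
  moves the limit inside the integral.\<close>
lemma has_vector_derivative_convolution:
  fixes g g' f :: "real \<Rightarrow> complex"
  assumes deriv: "\<And>x. (g has_vector_derivative g' x) (at x)"
    and g_le: "\<And>x. norm (g x) \<le> B / (1 + x\<^sup>2)"
    and g'_le: "\<And>x. norm (g' x) \<le> B / (1 + x\<^sup>2)"
    and f_meas [measurable]: "f \<in> borel_measurable borel"
    and f_le: "\<And>t. norm (f t) \<le> F"
  shows "((\<lambda>b. LINT t|lborel. g (t - b) * f t) has_vector_derivative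
           - (LINT t|lborel. g' (t - b) * f t)) (at b)"
proof -
  have B: "0 \<le> B" using order_trans[OF norm_ge_zero g_le[of 0]] by simp
  have F: "0 \<le> F" using order_trans[OF norm_ge_zero f_le[of 0]] .
  have cont: "continuous_on UNIV g"
    using deriv by (meson continuous_at_imp_continuous_on has_vector_derivative_continuous)
  note [measurable] = borel_measurable_continuous_onI[OF cont]
  have int: "integrable lborel (\<lambda>t. g (t - c) * f t)" for c
  proof (rule Bochner_Integration.integrable_bound[OF integrable_Cauchy_kernel[of "B * F" c]])
    show "AE t in lborel. norm (g (t - c) * f t) \<le> norm (B * F / (1 + (t - c)\<^sup>2))"
    proof (rule AE_I2)
      fix t
      have "norm (g (t - c)) * norm (f t) \<le> B / (1 + (t - c)\<^sup>2) * F"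
        using g_le f_le B by (intro mult_mono) auto
      also have "\<dots> \<le> norm (B * F / (1 + (t - c)\<^sup>2))" using B F by simp
      finally show "norm (g (t - c) * f t) \<le> norm (B * F / (1 + (t - c)\<^sup>2))"
        by (simp add: norm_mult)
    qed
  qed simp
  let ?q = "\<lambda>c t. ((g (t - c) - g (t - b)) /\<^sub>R (c - b)) * f t"
  have lim: "(\<lambda>n. LINT t|lborel. ?q (X n) t) \<longlonglongrightarrow> (LINT t|lborel. - (g' (t - b) * f t))"
    if X: "\<forall>n. X n \<noteq> b" "X \<longlonglongrightarrow> b" "\<And>n. \<bar>X n - b\<bar> \<le> 1" for X :: "nat \<Rightarrow> real"
  proof (rule integral_dominated_convergence[OF _ _ integrable_Cauchy_kernel[of "3 * B * F" b]])
    have pt: "(\<lambda>n. ?q (X n) t) \<longlonglongrightarrow> - (g' (t - b) * f t)" for t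
    proof -
      have "((\<lambda>c. g (t - c)) has_vector_derivative (- 1) *\<^sub>R g' (t - b)) (at b)"
        by (rule vector_diff_chain_at[of "\<lambda>c. t - c" "-1" b g, unfolded o_def])
          (auto intro!: derivative_eq_intros deriv)
      hence "((\<lambda>c. (g (t - c) - g (t - b)) /\<^sub>R (c - b)) \<longlongrightarrow> - g' (t - b)) (at b)"
        by (simp add: has_vector_derivative_at_quotient)
      hence "(\<lambda>n. (g (t - X n) - g (t - b)) /\<^sub>R (X n - b)) \<longlonglongrightarrow> - g' (t - b)"
        using X by (auto simp: tendsto_at_iff_sequentially comp_def)
      from tendsto_mult[OF this tendsto_const[of "f t"]] show ?thesis by simp
    qed
    show "AE t in lborel. (\<lambda>n. ?q (X n) t) \<longlonglongrightarrow> - (g' (t - b) * f t)"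
      using pt by simp
    show "(\<lambda>t. ?q (X n) t) \<in> borel_measurable lborel" for n by measurable
    \<comment> \<open>A pointwise limit of measurable difference quotients is measurable.\<close>
    show "(\<lambda>t. - (g' (t - b) * f t)) \<in> borel_measurable lborel"
      by (rule borel_measurable_LIMSEQ_metric[of "\<lambda>n. ?q (X n)"]) (use pt in simp_all)
    show "AE t in lborel. norm (?q (X n) t) \<le> 3 * B * F / (1 + (t - b)\<^sup>2)" for n
    proof (rule AE_I2)
      fix t
      let ?x = "t - b" and ?y = "t - X n"
      have "norm (g ?y - g ?x) \<le> 3 * B / (1 + ?x\<^sup>2) * norm (?y - ?x)"
      proof (rule differentiable_bound[where S = "closed_segment ?x ?y"])
        fix z assume z: "z \<in> closed_segment ?x ?y"
        show "(g has_derivative (\<lambda>h. h *\<^sub>R g' z)) (at z within closed_segment ?x ?y)"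
          using deriv[of z] by (simp add: has_vector_derivative_def has_derivative_at_withinI)
        have "\<bar>?x - z\<bar> \<le> 1"
          using segment_bound1[OF z] X(3)[of n] by (simp add: abs_minus_commute)
        from mult_left_mono[OF Cauchy_kernel_shift[OF this] B]
        have "norm (g' z) \<le> 3 * B / (1 + ?x\<^sup>2)"
          using g'_le[of z] by (simp add: mult.commute)
        thus "onorm (\<lambda>h. h *\<^sub>R g' z) \<le> 3 * B / (1 + ?x\<^sup>2)"
          by (intro onorm_le) (metis abs_ge_zero mult.commute mult_left_mono norm_scaleR real_norm_def)
      qed auto
      moreover have "norm (?y - ?x) = \<bar>X n - b\<bar>" by (simp add: abs_minus_commute)
      ultimately have "norm (g ?y - g ?x) / \<bar>X n - b\<bar> \<le> 3 * B / (1 + ?x\<^sup>2)"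
        using X(1) by (subst pos_divide_le_eq) auto
      hence "norm ((g ?y - g ?x) /\<^sub>R (X n - b)) \<le> 3 * B / (1 + ?x\<^sup>2)"
        by (simp only: norm_scaleR norm_inverse real_norm_def divide_inverse_commute abs_inverse)
      hence "norm ((g ?y - g ?x) /\<^sub>R (X n - b)) * norm (f t) \<le> 3 * B / (1 + ?x\<^sup>2) * F"
        using f_le B by (intro mult_mono) auto
      thus "norm (?q (X n) t) \<le> 3 * B * F / (1 + ?x\<^sup>2)"
        by (simp only: norm_mult times_divide_eq_left)
    qed
  qed
  have "((\<lambda>c. LINT t|lborel. ?q c t) \<longlongrightarrow> (LINT t|lborel. - (g' (t - b) * f t))) (at b)"
    unfolding tendsto_at_iff_sequentially comp_def
  proof (intro allI impI)
    fix X :: "nat \<Rightarrow> real" assume X: "\<forall>i. X i \<in> UNIV - {b}" "X \<longlonglongrightarrow> b"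
    then obtain n0 where n0: "\<And>n. n \<ge> n0 \<Longrightarrow> \<bar>X n - b\<bar> \<le> 1"
      using LIMSEQ_D[OF X(2), of 1] by (auto intro: less_imp_le)
    have "(\<lambda>n. LINT t|lborel. ?q (X (n + n0)) t) \<longlonglongrightarrow> (LINT t|lborel. - (g' (t - b) * f t))"
      by (rule lim) (use X n0 in \<open>auto intro: LIMSEQ_ignore_initial_segment\<close>)
    thus "(\<lambda>n. LINT t|lborel. ?q (X n) t) \<longlonglongrightarrow> (LINT t|lborel. - (g' (t - b) * f t))"
      by (rule LIMSEQ_offset)
  qed
  moreover have "(\<lambda>c. LINT t|lborel. ?q c t) = (\<lambda>c.
      ((LINT t|lborel. g (t - c) * f t) - (LINT t|lborel. g (t - b) * f t)) /\<^sub>R (c - b))"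
    unfolding mult_scaleR_left integral_scaleR_right left_diff_distrib
    by (simp only: Bochner_Integration.integral_diff[OF int int])
  ultimately show ?thesis
    by (simp only: has_vector_derivative_at_quotient Bochner_Integration.integral_minus)
qed

section \<open>Schwartz functions and wave packets\<close>

lemma smooth_has_vector_derivative:
  assumes "smooth g" shows "(g has_vector_derivative vderiv g t) (at t)"
  using assms[unfolded smooth_def, rule_format, of 0 t] by (simp add: vderiv_def vector_derivative_works)

lemma smooth_vderiv: "smooth g \<Longrightarrow> smooth (vderiv g)"
  unfolding smooth_def by (metis funpow_Suc_right o_apply)

lemma schwartz_vderiv: "schwartz g \<Longrightarrow> schwartz (vderiv g)"
  unfolding schwartz_def by (metis funpow_Suc_right o_apply smooth_vderiv)

lemma smooth_continuous: "smooth g \<Longrightarrow> continuous_on UNIV g"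
  by (meson smooth_has_vector_derivative continuous_at_imp_continuous_on has_vector_derivative_continuous)

lemma schwartz_decay:
  assumes "schwartz g"
  obtains B where "B \<ge> 0" "\<And>t. norm (g t) \<le> B / (1 + t\<^sup>2)"
proof -
  have "\<exists>B. \<forall>t. \<bar>t\<bar> ^ m * norm (g t) \<le> B" for m
    using assms unfolding schwartz_def by (metis funpow_0)
  then obtain B0 B2 where *: "\<And>t. \<bar>t\<bar> ^ 0 * norm (g t) \<le> B0" "\<And>t. \<bar>t\<bar> ^ 2 * norm (g t) \<le> B2"
    by metis
  have "(1 + t\<^sup>2) * norm (g t) \<le> B0 + B2" for t
    using *(1)[of t] *(2)[of t] by (simp add: distrib_right)
  moreover have "1 + t\<^sup>2 > 0" for t :: real by (simp add: add_pos_nonneg)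
  ultimately have *: "norm (g t) \<le> (B0 + B2) / (1 + t\<^sup>2)" for t
    by (simp add: field_simps)
  have "B0 + B2 \<ge> 0" using order_trans[OF norm_ge_zero *[of 0]] by simp
  with * show ?thesis using that by blast
qed

lemma wave_packet_translate: "wave_packet w s a b t = wave_packet w s a 0 (t - b)"
  by (simp add: wave_packet_def)

lemma continuous_on_wave_packet:
  assumes "continuous_on UNIV w"
  shows "continuous_on UNIV (wave_packet w s a b)"
  unfolding wave_packet_def[abs_def] cis_conv_exp
  by (intro continuous_intros continuous_on_compose2[OF assms]) auto

text \<open>The two terms are the source of the whole argument: the modulation returns the packet times its
  frequency \<open>a\<close>, the envelope contributes only the lower order \<open>\<bar>a\<bar> powr s\<close>.\<close>
lemma has_vector_derivative_wave_packet:
  assumes "smooth w"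
  shows "(wave_packet w s a 0 has_vector_derivative
    (of_real (\<bar>a\<bar> powr s) * wave_packet (vderiv w) s a 0 x + 2 * pi * \<i> * a * wave_packet w s a 0 x)) (at x)"
proof -
  let ?r = "\<bar>a\<bar> powr s"
  have "((\<lambda>x. w (?r * x)) has_vector_derivative ?r *\<^sub>R vderiv w (?r * x)) (at x)"
    by (rule vector_diff_chain_at[of "\<lambda>x. ?r * x" ?r x w, unfolded o_def])
      (auto intro!: derivative_eq_intros smooth_has_vector_derivative assms)
  moreover have "((\<lambda>x. cis (2 * pi * x * a)) has_vector_derivative (2 * pi * a) *\<^sub>R (\<i> * cis (2 * pi * x * a))) (at x)"
  proof -
    have "((\<lambda>x. of_real (2 * pi * a) * \<i> * complex_of_real x) has_vector_derivative of_real (2 * pi * a) * \<i>) (at x)"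
      by (auto intro!: derivative_eq_intros)
    from field_vector_diff_chain_at[OF this DERIV_exp]
    show ?thesis by (simp add: o_def cis_conv_exp scaleR_conv_of_real mult_ac)
  qed
  ultimately have "((\<lambda>x. of_real (\<bar>a\<bar> powr (s / 2)) * (w (?r * x) * cis (2 * pi * x * a))) has_vector_derivative
     of_real (\<bar>a\<bar> powr (s / 2)) * (w (?r * x) * ((2 * pi * a) *\<^sub>R (\<i> * cis (2 * pi * x * a)))
      + (?r *\<^sub>R vderiv w (?r * x)) * cis (2 * pi * x * a))) (at x)"
    by (intro has_vector_derivative_mult_right has_vector_derivative_mult)
  thus ?thesis
    by (simp add: wave_packet_def[abs_def] scaleR_conv_of_real algebra_simps)
qed

text \<open>For \<open>\<bar>a\<bar> \<ge> 1\<close> dilation only concentrates the envelope, so the bounding profile in \<open>t\<close> can be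
  chosen without reference to \<open>a\<close>; this makes dominated convergence in \<open>a\<close> possible.\<close>
lemma wave_packet_decay:
  assumes "\<And>t. norm (w t) \<le> B / (1 + t\<^sup>2)" "0 \<le> B" "\<bar>a\<bar> \<ge> 1" "0 \<le> s"
  shows "norm (wave_packet w s a 0 t) \<le> \<bar>a\<bar> powr (s / 2) * B / (1 + t\<^sup>2)"
proof -
  have "1 \<le> \<bar>a\<bar> powr s" using assms by (simp add: ge_one_powr_ge_zero)
  hence "t\<^sup>2 \<le> (\<bar>a\<bar> powr s * t)\<^sup>2"
    using mult_right_mono[of 1 "(\<bar>a\<bar> powr s)\<^sup>2" "t\<^sup>2"] by (simp add: power_mult_distrib)
  moreover have "1 + t\<^sup>2 > 0" by (simp add: add_pos_nonneg)
  ultimately have "B / (1 + (\<bar>a\<bar> powr s * t)\<^sup>2) \<le> B / (1 + t\<^sup>2)"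
    using assms by (intro divide_left_mono mult_pos_pos) auto
  hence "norm (w (\<bar>a\<bar> powr s * t)) \<le> B / (1 + t\<^sup>2)"
    using assms(1)[of "\<bar>a\<bar> powr s * t"] by linarith
  from mult_left_mono[OF this, of "\<bar>a\<bar> powr (s / 2)"]
  show ?thesis by (simp add: wave_packet_def norm_mult)
qed

section \<open>The wave packet transform and its instantaneous frequency\<close>

lemma wpt_integrable:
  assumes "schwartz w" "f \<in> borel_measurable borel" "\<And>t. norm (f t) \<le> F" "\<bar>a\<bar> \<ge> 1" "0 \<le> s"
  shows "integrable lborel (\<lambda>t. cnj (wave_packet w s a b t) * f t)"
proof -
  note [measurable] = assms(2)
  have F: "0 \<le> F" using order_trans[OF norm_ge_zero assms(3)[of 0]] .
  obtain B where B: "B \<ge> 0" "\<And>t. norm (w t) \<le> B / (1 + t\<^sup>2)"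
    using schwartz_decay[OF assms(1)] by blast
  have [measurable]: "wave_packet w s a b \<in> borel_measurable borel"
    using assms(1) by (intro borel_measurable_continuous_onI continuous_on_wave_packet smooth_continuous)
      (simp add: schwartz_def)
  have [measurable]: "cnj \<in> borel_measurable borel"
    by (intro borel_measurable_continuous_onI continuous_intros)
  show ?thesis
  proof (rule Bochner_Integration.integrable_bound
      [OF integrable_Cauchy_kernel[of "\<bar>a\<bar> powr (s / 2) * B * F" b]])
    show "AE t in lborel. norm (cnj (wave_packet w s a b t) * f t)
        \<le> norm (\<bar>a\<bar> powr (s / 2) * B * F / (1 + (t - b)\<^sup>2))"
    proof (rule AE_I2)
      fix t
      have "norm (wave_packet w s a b t) * norm (f t)
          \<le> \<bar>a\<bar> powr (s / 2) * B / (1 + (t - b)\<^sup>2) * F"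
        unfolding wave_packet_translate[of w s a b t]
        using B assms by (intro mult_mono wave_packet_decay) auto
      thus "norm (cnj (wave_packet w s a b t) * f t)
          \<le> norm (\<bar>a\<bar> powr (s / 2) * B * F / (1 + (t - b)\<^sup>2))"
        using B F by (simp add: norm_mult)
    qed
  qed measurable
qed

text \<open>In the transform as a function of \<open>b\<close>, the packet is a kernel evaluated at \<open>t - b\<close>. The
  convolution rule transfers the derivative to that kernel.\<close>
lemma vderiv_wpt:
  assumes "schwartz w" "f \<in> borel_measurable borel" "\<And>t. norm (f t) \<le> F" "\<bar>a\<bar> \<ge> 1" "0 \<le> s"
  shows "vderiv (wpt w s f a) b =
    2 * pi * \<i> * a * wpt w s f a b - of_real (\<bar>a\<bar> powr s) * wpt (vderiv w) s f a b"
proof -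
  let ?g = "\<lambda>x. cnj (wave_packet w s a 0 x)"
  let ?h = "\<lambda>x. cnj (wave_packet (vderiv w) s a 0 x)"
  let ?g' = "\<lambda>x. of_real (\<bar>a\<bar> powr s) * ?h x - 2 * pi * \<i> * a * ?g x"
  have w: "smooth w" using assms(1) by (simp add: schwartz_def)
  obtain B where B: "B \<ge> 0" "\<And>t. norm (w t) \<le> B / (1 + t\<^sup>2)"
    using schwartz_decay[OF assms(1)] by blast
  obtain B' where B': "B' \<ge> 0" "\<And>t. norm (vderiv w t) \<le> B' / (1 + t\<^sup>2)"
    using schwartz_decay[OF schwartz_vderiv[OF assms(1)]] by blast
  define A where "A = \<bar>a\<bar> powr (s / 2) * B"
  define A' where "A' = \<bar>a\<bar> powr (s / 2) * B'"
  have A: "0 \<le> A" "0 \<le> A'" using B B' by (simp_all add: A_def A'_def)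
  define D where "D = A + (\<bar>a\<bar> powr s * A' + 2 * pi * \<bar>a\<bar> * A)"
  have g: "norm (?g x) \<le> A / (1 + x\<^sup>2)" and h: "norm (?h x) \<le> A' / (1 + x\<^sup>2)" for x
    using wave_packet_decay[OF B(2,1) assms(4,5)] wave_packet_decay[OF B'(2,1) assms(4,5)]
    by (simp_all add: A_def A'_def)
  have pos: "1 + x\<^sup>2 > 0" for x :: real by (simp add: add_pos_nonneg)
  have "((\<lambda>b. LINT t|lborel. ?g (t - b) * f t) has_vector_derivative
          - (LINT t|lborel. ?g' (t - b) * f t)) (at b)"
  proof (rule has_vector_derivative_convolution[where B = D])
    fix x
    show "(?g has_vector_derivative ?g' x) (at x)"
      using has_vector_derivative_cnj[OF has_vector_derivative_wave_packet[OF w, of s a x]] by simp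
    have "A / (1 + x\<^sup>2) \<le> D / (1 + x\<^sup>2)"
      using A pos[of x] by (intro divide_right_mono) (auto simp: D_def)
    with g[of x] show "norm (?g x) \<le> D / (1 + x\<^sup>2)" by linarith
    have "norm (?g' x) \<le> \<bar>a\<bar> powr s * norm (?h x) + 2 * pi * \<bar>a\<bar> * norm (?g x)"
      using norm_triangle_ineq4[of "of_real (\<bar>a\<bar> powr s) * ?h x" "2 * pi * \<i> * a * ?g x"]
      by (simp add: norm_mult)
    also have "\<dots> \<le> \<bar>a\<bar> powr s * (A' / (1 + x\<^sup>2)) + 2 * pi * \<bar>a\<bar> * (A / (1 + x\<^sup>2))"
      using g[of x] h[of x] by (intro add_mono mult_left_mono) auto
    also have "\<dots> = (\<bar>a\<bar> powr s * A' + 2 * pi * \<bar>a\<bar> * A) / (1 + x\<^sup>2)"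
      by (simp add: add_divide_distrib)
    also have "\<dots> \<le> D / (1 + x\<^sup>2)"
      using A pos[of x] by (intro divide_right_mono) (auto simp: D_def)
    finally show "norm (?g' x) \<le> D / (1 + x\<^sup>2)" .
  qed (use assms in auto)
  moreover have "(\<lambda>b. LINT t|lborel. ?g (t - b) * f t) = wpt w s f a"
    by (simp add: wpt_def[abs_def] flip: wave_packet_translate)
  moreover have "(LINT t|lborel. ?g' (t - b) * f t) =
      of_real (\<bar>a\<bar> powr s) * wpt (vderiv w) s f a b - 2 * pi * \<i> * a * wpt w s f a b"
    using wpt_integrable[OF assms, of b] wpt_integrable[OF schwartz_vderiv[OF assms(1)] assms(2-), of b]
    by (simp add: wpt_def left_diff_distrib mult.assoc flip: wave_packet_translate)
  ultimately show ?thesis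
    by (simp add: vderiv_def vector_derivative_at)
qed

text \<open>The \<open>L\<^sup>1\<close>-norm of the packet scales as \<open>\<bar>a\<bar> powr (s / 2)\<close> from the normalisation times
  \<open>\<bar>a\<bar> powr (- s)\<close> from the dilation.\<close>
lemma norm_wpt_le:
  assumes "schwartz w" "f \<in> borel_measurable borel" "\<And>t. norm (f t) \<le> F" "\<bar>a\<bar> \<ge> 1" "0 \<le> s"
  shows "norm (wpt w s f a b) \<le> \<bar>a\<bar> powr (- s / 2) * (F * (LINT t|lborel. norm (w t)))"
proof -
  let ?r = "\<bar>a\<bar> powr s"
  have r: "?r > 0" using assms by simp
  obtain B where B: "B \<ge> 0" "\<And>t. norm (w t) \<le> B / (1 + t\<^sup>2)"
    using schwartz_decay[OF assms(1)] by blast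
  have [measurable]: "w \<in> borel_measurable borel"
    using assms(1) by (intro borel_measurable_continuous_onI smooth_continuous) (simp add: schwartz_def)
  have "integrable lborel w"
    by (rule Bochner_Integration.integrable_bound[OF integrable_Cauchy_kernel[of B 0]])
      (use B in auto)
  hence int: "integrable lborel (\<lambda>t. norm (w (- (?r * b) + ?r * t)))"
    using lborel_integrable_real_affine[of w ?r "- (?r * b)"] r by auto
  have "norm (wpt w s f a b) \<le> (LINT t|lborel. norm (cnj (wave_packet w s a b t) * f t))"
    unfolding wpt_def by (rule integral_norm_bound)
  also have "\<dots> \<le> (LINT t|lborel. \<bar>a\<bar> powr (s / 2) * F * norm (w (- (?r * b) + ?r * t)))"
  proof (rule integral_mono)
    show "integrable lborel (\<lambda>t. norm (cnj (wave_packet w s a b t) * f t))"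
      by (intro integrable_norm wpt_integrable[OF assms])
    show "integrable lborel (\<lambda>t. \<bar>a\<bar> powr (s / 2) * F * norm (w (- (?r * b) + ?r * t)))"
      using int by simp
    fix t
    have "\<bar>a\<bar> powr (s / 2) * norm (w (?r * (t - b))) * norm (f t)
        \<le> \<bar>a\<bar> powr (s / 2) * norm (w (?r * (t - b))) * F"
      by (intro mult_left_mono assms) auto
    moreover have "?r * (t - b) = - (?r * b) + ?r * t" by (simp add: algebra_simps)
    ultimately show "norm (cnj (wave_packet w s a b t) * f t)
        \<le> \<bar>a\<bar> powr (s / 2) * F * norm (w (- (?r * b) + ?r * t))"
      by (simp add: wave_packet_def norm_mult mult_ac)
  qed
  also have "\<dots> = \<bar>a\<bar> powr (s / 2) * F * ((LINT t|lborel. norm (w t)) / ?r)"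
    using lborel_integral_real_affine[of ?r "\<lambda>t. norm (w t)" "- (?r * b)"] r by simp
  also have "\<dots> = \<bar>a\<bar> powr (s / 2 - s) * (F * (LINT t|lborel. norm (w t)))"
    unfolding powr_diff by simp
  also have "s / 2 - s = - s / 2" by simp
  finally show ?thesis .
qed

text \<open>The threshold defining \<open>R_set\<close> decays in \<open>a\<close> exactly as the bound for the transform with
  respect to \<open>w'\<close>, so in the quotient only the factor \<open>\<bar>a\<bar> powr s\<close> from the envelope survives.\<close>
lemma inst_freq_near_scale:
  assumes "schwartz w" "f \<in> borel_measurable borel" "\<And>t. norm (f t) \<le> F" "0 \<le> s" "0 < \<epsilon>"
    and R: "(a, b) \<in> R_set w s \<epsilon> f"
  shows "\<exists>v. inst_freq w s f a b = Some v \<and>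
    norm (v - of_real a) \<le> F * (LINT t|lborel. norm (vderiv w t)) / (2 * pi * sqrt \<epsilon>) * \<bar>a\<bar> powr s"
proof -
  define L where "L = F * (LINT t|lborel. norm (vderiv w t))"
  let ?W = "wpt w s f a b" and ?V = "wpt (vderiv w) s f a b" and ?p = "\<bar>a\<bar> powr (- s / 2)"
  have a: "\<bar>a\<bar> \<ge> 1" and W: "norm ?W \<ge> ?p * sqrt \<epsilon>" using R by (auto simp: R_set_def)
  have p: "?p > 0" using a by simp
  have "?p * sqrt \<epsilon> > 0" using p \<open>0 < \<epsilon>\<close> by simp
  with W have W0: "norm ?W > 0" by linarith
  define v where "v = vderiv (wpt w s f a) b / (2 * of_real pi * \<i> * ?W)"
  have "inst_freq w s f a b = Some v" using W0 by (simp add: inst_freq_def v_def)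
  moreover have "v - of_real a = - (of_real (\<bar>a\<bar> powr s) * ?V / (2 * of_real pi * \<i> * ?W))"
    using W0 unfolding v_def vderiv_wpt[OF assms(1-3) a assms(4)] by (simp add: field_simps)
  hence "norm (v - of_real a) = \<bar>a\<bar> powr s * (norm ?V / norm ?W) / (2 * pi)"
    by (simp add: norm_mult norm_divide)
  moreover have "norm ?V / norm ?W \<le> (?p * L) / (?p * sqrt \<epsilon>)"
    using norm_wpt_le[OF schwartz_vderiv[OF assms(1)] assms(2,3) a assms(4), of b] W p \<open>0 < \<epsilon>\<close> W0
    by (intro frac_le) (auto simp: L_def intro: order_trans[OF norm_ge_zero])
  hence "\<bar>a\<bar> powr s * (norm ?V / norm ?W) / (2 * pi) \<le> \<bar>a\<bar> powr s * (L / sqrt \<epsilon>) / (2 * pi)"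
    using p by (intro divide_right_mono mult_left_mono) auto
  ultimately show ?thesis by (intro exI[of _ v]) (simp add: L_def mult_ac)
qed

text \<open>Dominated convergence along a sequence of scales; the normalising factors
  \<open>\<bar>X n\<bar> powr (s / 2)\<close> stay bounded because they converge.\<close>
lemma continuous_on_wpt:
  assumes "schwartz w" "f \<in> borel_measurable borel" "\<And>t. norm (f t) \<le> F" "0 \<le> s"
  shows "continuous_on {a. \<bar>a\<bar> \<ge> 1} (\<lambda>a. wpt w s f a b)"
  unfolding continuous_on_sequentially comp_def
proof (intro allI ballI impI, elim conjE)
  fix X :: "nat \<Rightarrow> real" and a
  assume a: "a \<in> {a. \<bar>a\<bar> \<ge> 1}" and X: "\<forall>n. X n \<in> {a. \<bar>a\<bar> \<ge> 1}" "X \<longlonglongrightarrow> a"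
  note [measurable] = assms(2)
  have F: "0 \<le> F" using order_trans[OF norm_ge_zero assms(3)[of 0]] .
  obtain B where B: "B \<ge> 0" "\<And>t. norm (w t) \<le> B / (1 + t\<^sup>2)"
    using schwartz_decay[OF assms(1)] by blast
  have w: "continuous_on UNIV w"
    using assms(1) by (intro smooth_continuous) (simp add: schwartz_def)
  have [measurable]: "wave_packet w s a b \<in> borel_measurable borel" for a
    by (intro borel_measurable_continuous_onI continuous_on_wave_packet w)
  have [measurable]: "cnj \<in> borel_measurable borel"
    by (intro borel_measurable_continuous_onI continuous_intros)
  have lim_a: "(\<lambda>n. \<bar>X n\<bar> powr r) \<longlonglongrightarrow> \<bar>a\<bar> powr r" for r
    using a X by (intro tendsto_intros) auto
  have "Bseq (\<lambda>n. \<bar>X n\<bar> powr (s / 2))"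
    using lim_a by (intro convergent_imp_Bseq convergentI)
  then obtain P where P: "P > 0" "\<And>n. \<bar>X n\<bar> powr (s / 2) \<le> P"
    by (auto simp: Bseq_def)
  show "(\<lambda>n. wpt w s f (X n) b) \<longlonglongrightarrow> wpt w s f a b"
    unfolding wpt_def
  proof (rule integral_dominated_convergence[OF _ _ integrable_Cauchy_kernel[of "P * B * F" b]])
    have "(\<lambda>n. w (\<bar>X n\<bar> powr s * (t - b))) \<longlonglongrightarrow> w (\<bar>a\<bar> powr s * (t - b))" for t
      by (rule continuous_on_tendsto_compose[OF w]) (auto intro!: tendsto_intros lim_a)
    thus "AE t in lborel. (\<lambda>n. cnj (wave_packet w s (X n) b t) * f t) \<longlonglongrightarrow> cnj (wave_packet w s a b t) * f t"
      unfolding wave_packet_def cis_conv_exp using X(2) lim_a a by (intro AE_I2 tendsto_intros) auto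
    show "AE t in lborel. norm (cnj (wave_packet w s (X n) b t) * f t) \<le> P * B * F / (1 + (t - b)\<^sup>2)" for n
    proof (rule AE_I2)
      fix t
      have "norm (wave_packet w s (X n) b t) \<le> \<bar>X n\<bar> powr (s / 2) * B / (1 + (t - b)\<^sup>2)"
        unfolding wave_packet_translate[of w s "X n" b t]
        using X by (intro wave_packet_decay[OF B(2,1)] assms) auto
      also have "\<dots> \<le> P * B / (1 + (t - b)\<^sup>2)"
        using P B by (intro divide_right_mono mult_right_mono) auto
      finally have "norm (wave_packet w s (X n) b t) * norm (f t) \<le> P * B / (1 + (t - b)\<^sup>2) * F"
        using assms P B by (intro mult_mono) auto
      thus "norm (cnj (wave_packet w s (X n) b t) * f t) \<le> P * B * F / (1 + (t - b)\<^sup>2)"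
        by (simp add: norm_mult)
    qed
  qed measurable
qed

section \<open>Extreme scales of a zone\<close>

text \<open>If \<open>\<bar>a\<bar> \<le> \<bar>l\<bar>\<close>, the error \<open>E * \<bar>a\<bar> powr s\<close> is controlled by its value at \<open>\<bar>l\<bar>\<close>, even when
  \<open>a\<close> itself lies below the threshold \<open>T\<close>. Otherwise \<open>a\<close> is negative and beyond the threshold, its error is
  a fraction \<open>\<delta>\<close> of \<open>\<bar>a\<bar>\<close>, and moving from \<open>a\<close> up to \<open>- \<bar>l\<bar>\<close> only increases \<open>a * (1 - \<delta>)\<close>. The sign
  of \<open>\<theta>\<close> follows that of \<open>l\<close>, so that the upper bound is \<open>l + \<delta> * \<bar>l\<bar>\<close> in both cases.\<close>
lemma edge_upper_bound:
  fixes a l r \<delta> T E s :: real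
  assumes small: "\<And>x. x \<ge> T \<Longrightarrow> E * x powr s \<le> \<delta> * x"
    and \<delta>: "0 \<le> \<delta>" "\<delta> \<le> 1" and "0 \<le> E" "0 \<le> s" and l: "\<bar>l\<bar> \<ge> T"
    and r: "\<bar>r - a\<bar> \<le> E * \<bar>a\<bar> powr s" and "a \<le> l"
  shows "\<exists>\<theta>. \<bar>\<theta>\<bar> \<le> \<delta> \<and> r \<le> l * (1 + \<theta>)"
proof (intro exI conjI)
  show "\<bar>\<delta> * sgn l\<bar> \<le> \<delta>" using \<delta> by (simp add: sgn_if)
  have rhs: "l * (1 + \<delta> * sgn l) = l + \<delta> * \<bar>l\<bar>"
    by (simp add: distrib_left abs_sgn mult_ac)
  show "r \<le> l * (1 + \<delta> * sgn l)"
  proof (cases "\<bar>a\<bar> \<le> \<bar>l\<bar>")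
    case True
    have "E * \<bar>a\<bar> powr s \<le> E * \<bar>l\<bar> powr s"
      using True assms by (intro mult_left_mono powr_mono2) auto
    also have "\<dots> \<le> \<delta> * \<bar>l\<bar>" using small l by blast
    finally show ?thesis using r \<open>a \<le> l\<close> unfolding rhs by linarith
  next
    case False
    hence a: "a < 0" "\<bar>l\<bar> \<le> -a" using \<open>a \<le> l\<close> by linarith+
    have "E * \<bar>a\<bar> powr s \<le> \<delta> * \<bar>a\<bar>" using small False l by auto
    hence "r \<le> - ((1 - \<delta>) * (- a))" using r a by (simp add: algebra_simps)
    also have "\<dots> \<le> - ((1 - \<delta>) * \<bar>l\<bar>)" using a \<delta> by (intro le_imp_neg_le mult_left_mono) auto
    also have "\<dots> \<le> l + \<delta> * \<bar>l\<bar>" by (simp add: algebra_simps)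
    finally show ?thesis unfolding rhs .
  qed
qed

lemma edge_lower_bound:
  fixes a u r \<delta> T E s :: real
  assumes small: "\<And>x. x \<ge> T \<Longrightarrow> E * x powr s \<le> \<delta> * x"
    and \<delta>: "0 \<le> \<delta>" "\<delta> \<le> 1" and "0 \<le> E" "0 \<le> s" and u: "\<bar>u\<bar> \<ge> T"
    and r: "\<bar>r - a\<bar> \<le> E * \<bar>a\<bar> powr s" and "a \<ge> u"
  shows "\<exists>\<theta>. \<bar>\<theta>\<bar> \<le> \<delta> \<and> r \<ge> u * (1 - \<theta>)"
proof -
  obtain \<theta> where "\<bar>\<theta>\<bar> \<le> \<delta>" "- r \<le> (- u) * (1 + \<theta>)"
    using edge_upper_bound[OF small, where a = "- a" and l = "- u" and r = "- r"] assms
    by (auto simp: abs_minus_commute)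
  thus ?thesis by (intro exI[of _ "- \<theta>"]) auto
qed

lemma powr_le_linear:
  fixes s \<eta> :: real
  assumes "s < 1" "\<eta> > 0"
  obtains T where "T \<ge> 1" "\<And>x. x \<ge> T \<Longrightarrow> x powr s \<le> \<eta> * x"
proof
  let ?T = "max 1 ((1 / \<eta>) powr (1 / (1 - s)))"
  show "?T \<ge> 1" by simp
  fix x assume x: "x \<ge> ?T"
  have "1 / \<eta> = ((1 / \<eta>) powr (1 / (1 - s))) powr (1 - s)"
    using assms by (simp add: powr_powr)
  also have "\<dots> \<le> x powr (1 - s)" using x assms by (intro powr_mono2) auto
  also have "\<dots> = x / x powr s" using x by (simp add: powr_diff)
  finally have "x powr s \<le> x * \<eta>" using x assms by (simp add: field_simps)
  thus "x powr s \<le> \<eta> * x" by (simp add: mult.commute)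
qed

text \<open>The set of scales is closed by continuity of the transform, and bounded because
  \<open>d * \<bar>a\<bar> powr s\<close> is eventually smaller than \<open>\<bar>a\<bar> / 2\<close>.\<close>
lemma R_set_meets_Z_set_extremal:
  fixes w f s d N \<phi> n \<epsilon> b
  defines "S \<equiv> {a. (a, b) \<in> R_set w s \<epsilon> f \<inter> Z_set d s N \<phi> n}"
  assumes "schwartz w" "f \<in> borel_measurable borel" "\<And>t. norm (f t) \<le> F" "0 \<le> s" "s < 1" "0 < d"
    and "S \<noteq> {}"
  shows "\<exists>l u. is_min S l \<and> is_max S u"
proof -
  define c where "c = of_int n * N * vderiv \<phi> b"
  obtain T where T: "T \<ge> 1" "\<And>x. x \<ge> T \<Longrightarrow> x powr s \<le> 1 / (2 * d) * x"
    using powr_le_linear[of s "1 / (2 * d)"] assms by auto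
  have "S = {a \<in> {a. \<bar>a\<bar> \<ge> 1}. \<bar>a\<bar> powr (- s / 2) * sqrt \<epsilon> \<le> norm (wpt w s f a b)}
      \<inter> {a \<in> {a. \<bar>a\<bar> \<ge> 1}. \<bar>a - c\<bar> \<le> d * \<bar>a\<bar> powr s}"
    by (auto simp: S_def R_set_def Z_set_def c_def)
  moreover have "closed {a::real. \<bar>a\<bar> \<ge> 1}"
    by (intro closed_Collect_le continuous_intros)
  hence "closed ({a \<in> {a. \<bar>a\<bar> \<ge> 1}. \<bar>a\<bar> powr (- s / 2) * sqrt \<epsilon> \<le> norm (wpt w s f a b)}
      \<inter> {a \<in> {a. \<bar>a\<bar> \<ge> 1}. \<bar>a - c\<bar> \<le> d * \<bar>a\<bar> powr s})"
    by (intro closed_Int continuous_on_closed_Collect_le continuous_intros continuous_on_wpt[where F = F] assms) auto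
  ultimately have "closed S" by (simp only:)
  moreover have "bounded S"
  proof (rule boundedI)
    fix a assume "a \<in> S"
    hence "\<bar>a - c\<bar> \<le> d * \<bar>a\<bar> powr s" by (auto simp: S_def Z_set_def c_def)
    moreover have "d * \<bar>a\<bar> powr s \<le> \<bar>a\<bar> / 2" if "\<bar>a\<bar> \<ge> T"
      using mult_left_mono[OF T(2)[OF that], of d] \<open>0 < d\<close> by simp
    ultimately show "norm a \<le> T + 2 * \<bar>c\<bar>" using T(1) by (cases "\<bar>a\<bar> \<ge> T") auto
  qed
  ultimately have "compact S" by (simp add: compact_eq_bounded_closed)
  thus ?thesis
    using compact_attains_inf[of S] compact_attains_sup[of S] \<open>S \<noteq> {}\<close>
    unfolding is_min_def is_max_def by metis
qed

section \<open>Superpositions of intrinsic mode type functions\<close>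

lemma shape_class_continuous:
  assumes "\<sigma> \<in> shape_class M"
  shows "continuous_on UNIV \<sigma>"
proof (rule uniform_limit_theorem)
  show "uniform_limit UNIV (\<lambda>m t. \<Sum>n = - int m..int m. fcoeff \<sigma> n * cis (of_int n * t)) \<sigma> sequentially"
    using assms by (simp add: shape_class_def)
  show "\<forall>\<^sub>F m in sequentially. continuous_on UNIV (\<lambda>t. \<Sum>n = - int m..int m. fcoeff \<sigma> n * cis (of_int n * t))"
    unfolding cis_conv_exp by (intro always_eventually allI continuous_intros)
qed simp

text \<open>A shape bounded by some \<open>M \<le> 0\<close> would vanish, against its unit norm.\<close>
lemma shape_class_pos:
  assumes "\<sigma> \<in> shape_class M"
  shows "M > 0"
proof (rule ccontr)
  assume "\<not> M > 0"
  moreover have "norm (\<sigma> t) \<le> M" for t using assms by (simp add: shape_class_def)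
  ultimately have "\<sigma> t = 0" for t by (metis norm_le_zero_iff not_le order_trans)
  moreover have "sqrt (LINT t:{-pi..pi}|lborel. (norm (\<sigma> t))\<^sup>2) = 1"
    using assms by (simp add: shape_class_def)
  ultimately show False by simp
qed

lemma wGF_bounded_measurable:
  assumes "wGF_decomposition P M N K0 K s d f \<alpha> \<sigma> Nk \<phi>"
  shows "f \<in> borel_measurable borel" and "norm (f t) \<le> real K * M\<^sup>2"
proof -
  have f: "f = (\<lambda>t. \<Sum>k = 1..K. of_real (\<alpha> k t) * \<sigma> k (2 * pi * Nk k * \<phi> k t))"
    using assms unfolding wGF_decomposition_def by blast
  have g: "gimt M (Nk k) (\<lambda>t. of_real (\<alpha> k t) * \<sigma> k (2 * pi * Nk k * \<phi> k t)) (\<alpha> k) (\<sigma> k) (\<phi> k)"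
    if "k \<in> {1..K}" for k
    using assms that unfolding wGF_decomposition_def by blast
  have "continuous_on UNIV f"
    unfolding f
  proof (intro continuous_on_sum continuous_on_mult continuous_on_of_real)
    fix k assume "k \<in> {1..K}"
    with g have s: "smooth (\<alpha> k)" "smooth (\<phi> k)" "\<sigma> k \<in> shape_class M" unfolding gimt_def by blast+
    show "continuous_on UNIV (\<alpha> k)" by (rule smooth_continuous) fact
    show "continuous_on UNIV (\<lambda>t. \<sigma> k (2 * pi * Nk k * \<phi> k t))"
      by (rule continuous_on_compose2[OF shape_class_continuous[OF s(3)]])
        (intro continuous_on_mult continuous_on_const smooth_continuous s(2) subset_UNIV)+
  qed
  thus "f \<in> borel_measurable borel" by (rule borel_measurable_continuous_onI)
  have "norm (f t) \<le> (\<Sum>k = 1..K. M\<^sup>2)"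
    unfolding f
  proof (rule sum_norm_le)
    fix k assume "k \<in> {1..K}"
    from g[OF this] have k: "\<sigma> k \<in> shape_class M" "1 / M \<le> \<alpha> k t" "\<alpha> k t \<le> M"
      unfolding gimt_def by blast+
    have "M > 0" using shape_class_pos[OF k(1)] .
    moreover have "0 \<le> \<alpha> k t" using k(2) \<open>M > 0\<close> order_trans[of 0 "1 / M"] by simp
    moreover have "norm (\<sigma> k (2 * pi * Nk k * \<phi> k t)) \<le> M" using k by (simp add: shape_class_def)
    ultimately show "norm (of_real (\<alpha> k t) * \<sigma> k (2 * pi * Nk k * \<phi> k t)) \<le> M\<^sup>2"
      using k by (simp add: norm_mult power2_eq_square mult_mono)
  qed
  thus "norm (f t) \<le> real K * M\<^sup>2" by simp
qed

lemma freq_lower_bound: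
  assumes "wGF_decomposition P M N K0 K s d f \<alpha> \<sigma> Nk \<phi>" "j \<in> {1..K}" "N > 0" "m \<noteq> 0"
  shows "M > 0" and "N / M \<le> \<bar>of_int m * Nk j * vderiv (\<phi> j) b\<bar>"
proof -
  have j: "N \<le> Nk j" "\<sigma> j \<in> shape_class M" "1 / M \<le> \<bar>vderiv (\<phi> j) b\<bar>"
    using assms unfolding wGF_decomposition_def gimt_def by blast+
  show M: "M > 0" using shape_class_pos[OF j(2)] .
  have "1 * N * (1 / M) \<le> \<bar>of_int m\<bar> * Nk j * \<bar>vderiv (\<phi> j) b\<bar>"
    using j assms M by (intro mult_mono mult_nonneg_nonneg) auto
  thus "N / M \<le> \<bar>of_int m * Nk j * vderiv (\<phi> j) b\<bar>"
    using j assms by (simp add: abs_mult)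
qed

text \<open>At the scale \<open>a = p c\<close> the harmonics \<open>p, p + 1, \<dots>\<close> of one component have centres \<open>0, \<bar>c\<bar>, 2 \<bar>c\<bar>, \<dots>\<close>
  away from \<open>a\<close>, while the zones have half-width \<open>d * \<bar>a\<bar> powr s\<close>. For \<open>p\<close> large, \<open>K0 + 1\<close> of them
  contain \<open>a\<close>.\<close>
lemma all_pairs_overlap_unbounded:
  assumes wGF: "wGF_decomposition (all_pairs K) M N K0 K s d f \<alpha> \<sigma> Nk \<phi>"
    and "N > 0" "0 < s" "0 < d"
  shows "K = 0"
proof (rule ccontr)
  assume "K \<noteq> 0"
  hence one: "1 \<in> {1..K}" by auto
  define c where "c = Nk 1 * vderiv (\<phi> 1) 0"
  have "\<bar>c\<bar> \<ge> N / M" "M > 0"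
    using freq_lower_bound(1)[OF wGF one \<open>N > 0\<close>, of 1]
      freq_lower_bound(2)[OF wGF one \<open>N > 0\<close>, of 1 0] by (simp_all add: c_def)
  hence c: "\<bar>c\<bar> > 0" using \<open>N > 0\<close> by (metis divide_pos_pos less_le_trans)
  obtain p :: nat where p: "real p > (real K0 * \<bar>c\<bar> / d) powr (1 / s) / \<bar>c\<bar>"
    using reals_Archimedean2 by blast
  define a where "a = real p * c"
  have "(real K0 * \<bar>c\<bar> / d) powr (1 / s) \<le> \<bar>a\<bar>"
    using p c by (simp add: a_def abs_mult field_simps)
  hence "((real K0 * \<bar>c\<bar> / d) powr (1 / s)) powr s \<le> \<bar>a\<bar> powr s"
    using \<open>0 < s\<close> by (intro powr_mono2) auto
  hence a: "real K0 * \<bar>c\<bar> \<le> d * \<bar>a\<bar> powr s"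
    using assms by (simp add: powr_powr field_simps)
  have p0: "p > 0"
    using p c by (metis divide_nonneg_pos gr0I less_le_not_le of_nat_0 powr_ge_zero)
  let ?A = "{(n, k) \<in> all_pairs K. (a, 0) \<in> Z_set d s (Nk k) (\<phi> k) n}"
  have "(int (p + i), 1) \<in> ?A" if "i \<le> K0" for i
  proof -
    have "a - of_int (int (p + i)) * Nk 1 * vderiv (\<phi> 1) 0 = - (real i * c)"
      by (simp add: a_def c_def algebra_simps)
    moreover have "real i * \<bar>c\<bar> \<le> real K0 * \<bar>c\<bar>" using that by (intro mult_right_mono) auto
    ultimately show ?thesis using a p0 one by (simp add: all_pairs_def Z_set_def abs_mult)
  qed
  hence sub: "(\<lambda>i. (int (p + i), 1)) ` {..K0} \<subseteq> ?A" by blast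
  have A: "finite ?A" "card ?A \<le> K0"
    using wGF unfolding wGF_decomposition_def by blast+
  have "card ((\<lambda>i. (int (p + i), 1::nat)) ` {..K0}) \<le> K0"
    using card_mono[OF A(1) sub] A(2) by (rule order_trans)
  moreover have "card ((\<lambda>i. (int (p + i), 1::nat)) ` {..K0}) = Suc K0"
    by (subst card_image) (auto simp: inj_on_def)
  ultimately show False by simp
qed

text \<open>On \<open>R_set\<close> the instantaneous frequency is close to \<open>a\<close>, in the zone \<open>a\<close> is close to the
  centre, and both distances are of order \<open>\<bar>a\<bar> powr s\<close>. A nonzero harmonic of a component with
  frequency at least \<open>N\<close> has its zone at scales where this order is negligible against \<open>\<bar>a\<bar>\<close>.\<close>
lemma wGF_estimates:
  assumes "0 < s" "s < 1" "mother_wave_packet d w" "0 < \<epsilon>"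
  shows "\<exists>N0>0. \<forall>N>N0. \<forall>P f \<alpha> \<sigma> Nk \<phi> j m.
      wGF_decomposition P M N K0 K s d f \<alpha> \<sigma> Nk \<phi> \<and> j \<in> {1..K} \<and> m \<noteq> 0 \<longrightarrow>
        freq_estimate 1 w s d \<epsilon> f (Nk j) (\<phi> j) m \<and>
        edge_estimate (R_set w s \<epsilon> f) 1 w s d \<epsilon> f (Nk j) (\<phi> j) m"
proof -
  note s = assms(1,2) and \<epsilon> = assms(4)
  have w: "schwartz w" and d: "0 < d" "d \<le> 1"
    using assms(3) by (auto simp: mother_wave_packet_def)
  define E where "E = real K * M\<^sup>2 * (LINT t|lborel. norm (vderiv w t)) / (2 * pi * sqrt \<epsilon>)"
  have E: "E \<ge> 0" using \<epsilon> by (simp add: E_def)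
  \<comment> \<open>The relative error aimed for; it is capped at 1 so that factors \<open>1 - \<delta>\<close> stay nonnegative.\<close>
  define \<delta> where "\<delta> = min 1 (sqrt \<epsilon>)"
  have \<delta>: "0 < \<delta>" "\<delta> \<le> 1" "\<delta> \<le> sqrt \<epsilon>" using \<epsilon> by (auto simp: \<delta>_def)
  obtain T where T: "T \<ge> 1" "\<And>x. x \<ge> T \<Longrightarrow> x powr s \<le> \<delta> / (2 * (E + 1)) * x"
    using powr_le_linear[of s "\<delta> / (2 * (E + 1))"] s \<delta> E by auto
  \<comment> \<open>The summand 1 accounts for the distance between \<open>a\<close> and the centre of its zone, as \<open>d \<le> 1\<close>;
    the factor 1/2 for passing from \<open>\<bar>a\<bar>\<close> to \<open>\<bar>c b\<bar>\<close>.\<close>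
  have small: "(E + 1) * x powr s \<le> \<delta> * x / 2" if "x \<ge> T" for x
    using T(2)[OF that] E by (simp add: field_simps)
  show ?thesis
  \<comment> \<open>Chosen so that \<open>N / M \<ge> 2 T\<close>: the centres then have size at least \<open>2 T\<close>, hence the scales of the
    zone have size at least \<open>T\<close>. The maximum keeps the threshold positive for every \<open>M\<close>.\<close>
  proof (rule exI[of _ "2 * T * max 1 M"], intro conjI[of "2 * T * max 1 M > 0"] allI impI, goal_cases)
    case 1
    show ?case using T(1) by simp
  next
    case (2 N P f \<alpha> \<sigma> Nk \<phi> j m)
    hence N: "N > 2 * T * max 1 M" and wGF: "wGF_decomposition P M N K0 K s d f \<alpha> \<sigma> Nk \<phi>"
      and j: "j \<in> {1..K}" and m: "m \<noteq> 0" by blast+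
    have "2 * T * max 1 M > 0" using T(1) by simp
    hence N0: "N > 0" using N by linarith
    define c where "c = (\<lambda>b. of_int m * Nk j * vderiv (\<phi> j) b)"
    have c: "\<bar>c b\<bar> \<ge> 2 * T" for b
    proof -
      note c = freq_lower_bound(1)[OF wGF j N0 m] freq_lower_bound(2)[OF wGF j N0 m, of b]
      have "2 * T * M \<le> 2 * T * max 1 M" using T(1) by (intro mult_left_mono) auto
      hence "2 * T \<le> N / M" using N c(1) by (simp add: field_simps)
      with c(2) show ?thesis by (simp add: c_def)
    qed
    have near_scale: "\<exists>v. inst_freq w s f a b = Some v \<and> norm (v - of_real a) \<le> E * \<bar>a\<bar> powr s"
      if "(a, b) \<in> R_set w s \<epsilon> f" for a b
      unfolding E_def using s \<epsilon> that
      by (intro inst_freq_near_scale w wGF_bounded_measurable[OF wGF]) auto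
    have zone: "T \<le> \<bar>a\<bar>" "\<bar>a\<bar> \<le> 2 * \<bar>c b\<bar>" "\<bar>a - c b\<bar> \<le> \<bar>a\<bar> powr s"
      if "\<bar>a\<bar> \<ge> 1" "(a, b) \<in> Z_set d s (Nk j) (\<phi> j) m" for a b
    proof -
      have "\<bar>a - c b\<bar> \<le> d * \<bar>a\<bar> powr s" using that by (simp add: Z_set_def c_def)
      also have "\<dots> \<le> 1 * \<bar>a\<bar> powr s" using d by (intro mult_right_mono) auto
      finally show *: "\<bar>a - c b\<bar> \<le> \<bar>a\<bar> powr s" by simp
      have "\<bar>a\<bar> powr s \<le> \<bar>a\<bar> powr 1" using that s by (intro powr_mono) auto
      thus a: "T \<le> \<bar>a\<bar>" using * c[of b] that by simp
      have "\<bar>a\<bar> powr s \<le> (E + 1) * \<bar>a\<bar> powr s" using E by (simp add: distrib_right)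
      also have "\<dots> \<le> \<delta> * \<bar>a\<bar> / 2" by (rule small[OF a])
      also have "\<dots> \<le> 1 * \<bar>a\<bar> / 2" using \<delta> by (intro divide_right_mono mult_right_mono) auto
      finally show "\<bar>a\<bar> \<le> 2 * \<bar>c b\<bar>" using * by linarith
    qed
    have "freq_estimate 1 w s d \<epsilon> f (Nk j) (\<phi> j) m"
      unfolding freq_estimate_def
    proof (safe, goal_cases)
      case (1 a b)
      have a: "\<bar>a\<bar> \<ge> 1" using 1 by (simp add: R_set_def)
      note z = zone[OF a 1(2)]
      obtain v where v: "inst_freq w s f a b = Some v" "norm (v - of_real a) \<le> E * \<bar>a\<bar> powr s"
        using near_scale[OF 1(1)] by blast
      have "norm (v - of_real (c b)) \<le> norm (v - of_real a) + \<bar>a - c b\<bar>"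
        using norm_triangle_ineq[of "v - of_real a" "of_real (a - c b)"]
        unfolding norm_of_real by simp
      also have "\<dots> \<le> (E + 1) * \<bar>a\<bar> powr s" using v(2) z(3) by (simp add: distrib_right)
      also have "\<dots> \<le> \<delta> * \<bar>a\<bar> / 2" by (rule small[OF z(1)])
      also have "\<dots> \<le> \<delta> * \<bar>c b\<bar>" using mult_left_mono[OF z(2), of \<delta>] \<delta> by simp
      also have "\<dots> \<le> sqrt \<epsilon> * \<bar>c b\<bar>" using \<delta> by (intro mult_right_mono) auto
      finally have "norm (v - of_real (c b)) / \<bar>c b\<bar> \<le> 1 * sqrt \<epsilon>"
        using c[of b] T(1) by (simp add: field_simps)
      with v(1) show ?case unfolding c_def by (intro exI[of _ v] conjI)
    qed
    moreover have "edge_estimate (R_set w s \<epsilon> f) 1 w s d \<epsilon> f (Nk j) (\<phi> j) m"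
      unfolding edge_estimate_def Let_def
    proof (intro allI impI)
      fix b
      let ?S = "{a. (a, b) \<in> R_set w s \<epsilon> f \<inter> Z_set d s (Nk j) (\<phi> j) m}"
      assume "?S \<noteq> {}"
      then obtain l u where lu: "is_min ?S l" "is_max ?S u"
        using R_set_meets_Z_set_extremal[OF w wGF_bounded_measurable[OF wGF] less_imp_le[OF s(1)] s(2) d(1)]
        by blast
      have large: "T \<le> \<bar>l\<bar>" "T \<le> \<bar>u\<bar>"
        using lu zone by (auto simp: is_min_def is_max_def R_set_def)
      have small': "E * x powr s \<le> \<delta> * x" if "x \<ge> T" for x
      proof -
        have "E * x powr s \<le> (E + 1) * x powr s" by (simp add: distrib_right)
        moreover have "\<delta> * x \<ge> 0" using that T(1) \<delta> by simp
        ultimately show ?thesis using small[OF that] by linarith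
      qed
      have bounds: "(a \<le> l \<longrightarrow> (\<exists>\<theta>. \<bar>\<theta>\<bar> \<le> 1 * sqrt \<epsilon> \<and> Re v \<le> l * (1 + \<theta>))) \<and>
          (a \<ge> u \<longrightarrow> (\<exists>\<theta>. \<bar>\<theta>\<bar> \<le> 1 * sqrt \<epsilon> \<and> Re v \<ge> u * (1 - \<theta>)))"
        if "(a, b) \<in> R_set w s \<epsilon> f \<and> inst_freq w s f a b = Some v" for a v
      proof -
        have "norm (v - of_real a) \<le> E * \<bar>a\<bar> powr s" using near_scale that by fastforce
        with abs_Re_le_cmod[of "v - of_real a"] have r: "\<bar>Re v - a\<bar> \<le> E * \<bar>a\<bar> powr s" by simp
        have \<delta>0: "0 \<le> \<delta>" and s0: "0 \<le> s" using \<delta> s by simp_all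
        have weaken: "\<bar>\<theta>\<bar> \<le> 1 * sqrt \<epsilon>" if "\<bar>\<theta>\<bar> \<le> \<delta>" for \<theta> using that \<delta>(3) by simp
        show ?thesis
          using edge_upper_bound[OF small' \<delta>0 \<delta>(2) E s0 large(1) r]
            edge_lower_bound[OF small' \<delta>0 \<delta>(2) E s0 large(2) r] weaken by blast
      qed
      show "\<exists>l u. is_min ?S l \<and> is_max ?S u \<and>
         (\<forall>a v. (a, b) \<in> R_set w s \<epsilon> f \<and> inst_freq w s f a b = Some v \<longrightarrow>
           (a \<le> l \<longrightarrow> (\<exists>\<theta>. \<bar>\<theta>\<bar> \<le> 1 * sqrt \<epsilon> \<and> Re v \<le> l * (1 + \<theta>))) \<and>
           (a \<ge> u \<longrightarrow> (\<exists>\<theta>. \<bar>\<theta>\<bar> \<le> 1 * sqrt \<epsilon> \<and> Re v \<ge> u * (1 - \<theta>))))"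
        by (intro exI[of _ l] exI[of _ u] conjI[OF lu(1)] conjI[OF lu(2)] allI impI bounds)
    qed
    ultimately show ?case ..
  qed
qed

theorem theorem4p2:
  fixes M :: real and K0 K :: nat
  shows "\<exists>C>0. \<forall>s d w. 1 / 2 < s \<and> s < 1 \<and> mother_wave_packet d w \<longrightarrow>
    (\<forall>\<epsilon>>0. \<exists>N0>0. \<forall>N>N0. \<forall>f \<alpha> \<sigma> Nk \<phi>.
      (wGF_decomposition (all_pairs K) M N K0 K s d f \<alpha> \<sigma> Nk \<phi> \<longrightarrow>
        (\<forall>j\<in>{1..K}. \<exists>m. separated K s d \<sigma> Nk \<phi> j m) \<and>
        (\<forall>j\<in>{1..K}. \<forall>m. separated K s d \<sigma> Nk \<phi> j m \<longrightarrow>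
           freq_estimate C w s d \<epsilon> f (Nk j) (\<phi> j) m \<and>
           edge_estimate {(a, b). \<bar>a\<bar> \<ge> 1} C w s d \<epsilon> f (Nk j) (\<phi> j) m)) \<and>
      (wGF_decomposition (occurring_pairs K \<sigma>) M N K0 K s d f \<alpha> \<sigma> Nk \<phi> \<longrightarrow>
        (\<forall>j\<in>{1..K}. \<exists>m. separated K s d \<sigma> Nk \<phi> j m) \<and>
        (\<forall>j\<in>{1..K}. \<forall>m. separated K s d \<sigma> Nk \<phi> j m \<longrightarrow>
           freq_estimate C w s d \<epsilon> f (Nk j) (\<phi> j) m \<and>
           edge_estimate (R_set w s \<epsilon> f) C w s d \<epsilon> f (Nk j) (\<phi> j) m)))"
proof (rule exI[of _ 1], intro conjI allI impI)
  show "(1::real) > 0" by simp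
  fix s d :: real and w and \<epsilon> :: real
  assume "1 / 2 < s \<and> s < 1 \<and> mother_wave_packet d w" and \<epsilon>: "\<epsilon> > 0"
  hence s: "0 < s" "s < 1" and w: "mother_wave_packet d w" by auto
  have d: "0 < d" using w by (simp add: mother_wave_packet_def)
  from wGF_estimates[OF s w \<epsilon>, where M = M and ?K0.0 = K0 and K = K] obtain N0 where N0: "N0 > 0"
    "\<forall>N>N0. \<forall>P f \<alpha> \<sigma> Nk \<phi> j m.
      wGF_decomposition P M N K0 K s d f \<alpha> \<sigma> Nk \<phi> \<and> j \<in> {1..K} \<and> m \<noteq> 0 \<longrightarrow>
        freq_estimate 1 w s d \<epsilon> f (Nk j) (\<phi> j) m \<and>
        edge_estimate (R_set w s \<epsilon> f) 1 w s d \<epsilon> f (Nk j) (\<phi> j) m"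
    by (elim exE conjE)
  have nonzero: "m \<noteq> 0"
    if "wGF_decomposition P M N K0 K s d f \<alpha> \<sigma> Nk \<phi>" "j \<in> {1..K}" "separated K s d \<sigma> Nk \<phi> j m"
    for P N f \<alpha> \<sigma> Nk \<phi> j m
  proof
    assume "m = 0"
    have "\<sigma> j \<in> shape_class M" using that(1,2) unfolding wGF_decomposition_def gimt_def by blast
    thus False using that(3) \<open>m = 0\<close> by (simp add: shape_class_def separated_def)
  qed
  have no_all_pairs: "K = 0"
    if "N > N0" "wGF_decomposition (all_pairs K) M N K0 K s d f \<alpha> \<sigma> Nk \<phi>" for N f \<alpha> \<sigma> Nk \<phi>
    using all_pairs_overlap_unbounded[OF that(2) _ s(1) d] that(1) N0(1) by linarith
  have occurring: "(\<forall>j\<in>{1..K}. \<exists>m. separated K s d \<sigma> Nk \<phi> j m) \<and>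
        (\<forall>j\<in>{1..K}. \<forall>m. separated K s d \<sigma> Nk \<phi> j m \<longrightarrow>
           freq_estimate 1 w s d \<epsilon> f (Nk j) (\<phi> j) m \<and>
           edge_estimate (R_set w s \<epsilon> f) 1 w s d \<epsilon> f (Nk j) (\<phi> j) m)"
    if "N > N0" and wGF: "wGF_decomposition (occurring_pairs K \<sigma>) M N K0 K s d f \<alpha> \<sigma> Nk \<phi>"
    for N f \<alpha> \<sigma> Nk \<phi>
  proof (intro conjI[OF _ ballI] allI impI)
    show "\<forall>j\<in>{1..K}. \<exists>m. separated K s d \<sigma> Nk \<phi> j m"
      using wGF unfolding wGF_decomposition_def by blast
  next
    fix j m assume "j \<in> {1..K}" "separated K s d \<sigma> Nk \<phi> j m"
    with nonzero[OF wGF]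
    have "wGF_decomposition (occurring_pairs K \<sigma>) M N K0 K s d f \<alpha> \<sigma> Nk \<phi> \<and> j \<in> {1..K} \<and> m \<noteq> 0"
      using wGF by simp
    thus "freq_estimate 1 w s d \<epsilon> f (Nk j) (\<phi> j) m \<and>
        edge_estimate (R_set w s \<epsilon> f) 1 w s d \<epsilon> f (Nk j) (\<phi> j) m"
      using N0(2) that(1) by (elim allE impE) assumption+
  qed
  show "\<exists>N0>0. \<forall>N>N0. \<forall>f \<alpha> \<sigma> Nk \<phi>.
      (wGF_decomposition (all_pairs K) M N K0 K s d f \<alpha> \<sigma> Nk \<phi> \<longrightarrow>
        (\<forall>j\<in>{1..K}. \<exists>m. separated K s d \<sigma> Nk \<phi> j m) \<and>
        (\<forall>j\<in>{1..K}. \<forall>m. separated K s d \<sigma> Nk \<phi> j m \<longrightarrow>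
           freq_estimate 1 w s d \<epsilon> f (Nk j) (\<phi> j) m \<and>
           edge_estimate {(a, b). \<bar>a\<bar> \<ge> 1} 1 w s d \<epsilon> f (Nk j) (\<phi> j) m)) \<and>
      (wGF_decomposition (occurring_pairs K \<sigma>) M N K0 K s d f \<alpha> \<sigma> Nk \<phi> \<longrightarrow>
        (\<forall>j\<in>{1..K}. \<exists>m. separated K s d \<sigma> Nk \<phi> j m) \<and>
        (\<forall>j\<in>{1..K}. \<forall>m. separated K s d \<sigma> Nk \<phi> j m \<longrightarrow>
           freq_estimate 1 w s d \<epsilon> f (Nk j) (\<phi> j) m \<and>
           edge_estimate (R_set w s \<epsilon> f) 1 w s d \<epsilon> f (Nk j) (\<phi> j) m))"
  proof (rule exI[of _ N0], intro conjI[OF N0(1)] allI impI, rule conjI; rule impI)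
    fix N f \<alpha> \<sigma> Nk \<phi>
    assume N: "N0 < N" and "wGF_decomposition (all_pairs K) M N K0 K s d f \<alpha> \<sigma> Nk \<phi>"
    hence "K = 0" by (rule no_all_pairs)
    thus "(\<forall>j\<in>{1..K}. \<exists>m. separated K s d \<sigma> Nk \<phi> j m) \<and>
        (\<forall>j\<in>{1..K}. \<forall>m. separated K s d \<sigma> Nk \<phi> j m \<longrightarrow>
           freq_estimate 1 w s d \<epsilon> f (Nk j) (\<phi> j) m \<and>
           edge_estimate {(a, b). \<bar>a\<bar> \<ge> 1} 1 w s d \<epsilon> f (Nk j) (\<phi> j) m)" by simp
  qed (erule (1) occurring)
qed

end
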